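(* Let $h\ge2$, $g\ge1$ be integers, let $X$ be a discrete random variable with countable support $A$, let $f$ be any map on $\mathcal U_h=\mathcal U_h(A)$, let $0<\alpha\le1/h$, and suppose $\sum_{u\in\mathcal U_h}w_u^\alpha<\infty$. Then, with $d_\alpha:=\lvert2-2^\alpha\rvert$, $$\delta_{f,g}(X)\ \le\ \Bigl(\frac{\mathcal L_{\alpha,g}(f)}{d_\alpha}\Bigr)^{1/(h\alpha)} .$$
   Context: $\mathcal U_h(A)$ is the set of multisets of size $h$ with elements in $A$. $X_1,\dots,X_h$ are independent copies of $X$, $U_h=\{X_1,\dots,X_h\}$ is the resulting random multiset, and $w_u=\mathbb P(U_h=u)$ for $u\in\mathcal U_h$. Put $$\mathcal L_{\alpha,g}(f):=\inf_{\chi:\mathcal U_h\to\{1,\dots,g\}}\Bigl\lvert\sum_{u}w_u^\alpha-\sum_{(z,c)}\Bigl(\sum_{u:\,f(u)=z,\ \chi(u)=c}w_u\Bigr)^{\alpha}\Bigr\rvert,$$ the sum over $(z,c)$ running over the values $z$ of $f$ and $c\in\{1,\dots,g\}$. A set $B\subset A$ is $(f,g)$-admissible if every fibre of $f$ meets $\mathcal U_h(B)$ in at most $g$ multisets, and $\delta_{f,g}(X)=1-\sup\{\mathbb P(X\in B):B\subset A\text{ is }(f,g)\text{-admissible}\}$. (No group structure is used.) *)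

theory Defs
  imports "HOL-Probability.Probability"
begin

text \<open>
  A discrete random variable enters only through its law, a \<^typ>\<open>'a pmf\<close>; its (automatically
  countable) support is \<^const>\<open>set_pmf\<close>.  The set of multisets of size \<open>h\<close> over \<open>A\<close> is
  \<^const>\<open>multisets_of_size\<close>.  The map \<open>f\<close> is total on all multisets, but only its values on
  multisets over the support of \<open>X\<close> are ever used.
\<close>

definition random_multiset :: "nat \<Rightarrow> 'a pmf \<Rightarrow> 'a multiset pmf" where
  "random_multiset h X = map_pmf mset (replicate_pmf h X)"

definition weight :: "nat \<Rightarrow> 'a pmf \<Rightarrow> 'a multiset \<Rightarrow> real" where
  "weight h X u = pmf (random_multiset h X) u"

text \<open>
  The infimum of a set of reals is meaningful here: the set is bounded below by \<open>0\<close> and, for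
  \<open>g \<ge> 1\<close>, nonempty.  If the first sum converges and \<open>0 < \<alpha> \<le> 1\<close>, the sum over pairs
  converges too, by subadditivity of \<open>t \<mapsto> t powr \<alpha>\<close>; pairs \<open>(z, c)\<close> whose class is empty
  contribute \<open>0 powr \<alpha> = 0\<close>.
\<close>

definition colouring_loss ::
  "nat \<Rightarrow> 'a pmf \<Rightarrow> real \<Rightarrow> nat \<Rightarrow> ('a multiset \<Rightarrow> 'b) \<Rightarrow> real" where
  "colouring_loss h X \<alpha> g f =
     (INF chi \<in> multisets_of_size (set_pmf X) h \<rightarrow> {1..g}.
        \<bar>(\<Sum>\<^sub>\<infinity>u\<in>multisets_of_size (set_pmf X) h. weight h X u powr \<alpha>)
         - (\<Sum>\<^sub>\<infinity>(z, c)\<in>(f ` multisets_of_size (set_pmf X) h) \<times> {1..g}.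
              (\<Sum>\<^sub>\<infinity>u\<in>{u \<in> multisets_of_size (set_pmf X) h. f u = z \<and> chi u = c}.
                 weight h X u) powr \<alpha>)\<bar>)"

text \<open>Finiteness is required explicitly because \<^const>\<open>card\<close> is \<open>0\<close> on infinite sets.\<close>

definition admissible ::
  "nat \<Rightarrow> 'a set \<Rightarrow> ('a multiset \<Rightarrow> 'b) \<Rightarrow> nat \<Rightarrow> 'a set \<Rightarrow> bool" where
  "admissible h A f g B \<longleftrightarrow> B \<subseteq> A \<and>
     (\<forall>z. finite {u \<in> multisets_of_size B h. f u = z} \<and>
          card {u \<in> multisets_of_size B h. f u = z} \<le> g)"

definition deficiency :: "nat \<Rightarrow> 'a pmf \<Rightarrow> ('a multiset \<Rightarrow> 'b) \<Rightarrow> nat \<Rightarrow> real" where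
  "deficiency h X f g =
     1 - (SUP B \<in> {B. admissible h (set_pmf X) f g B}. measure_pmf.prob X B)"

end

theory Submission
  imports Defs
begin

text \<open>
  In each colour class keep one multiset of maximal weight.  Since
  \<open>(x + y) powr \<alpha> + (2 - 2 powr \<alpha>) * y powr \<alpha> \<le> x powr \<alpha> + y powr \<alpha>\<close> for \<open>0 \<le> y \<le> x\<close>, merging
  the other members into it one after another shows that the loss is at least \<open>2 - 2 powr \<alpha>\<close>
  times the sum of \<open>w\<^sub>u powr \<alpha>\<close> over the multisets \<open>u\<close> that are not kept.  Deleting from the
  support a least likely element \<open>x\<close> of each such \<open>u\<close> leaves an admissible set, because every
  fibre contains at most \<open>g\<close> kept multisets.  As \<open>w\<^sub>u \<ge> P(X = x)^h\<close> and \<open>h * \<alpha> \<le> 1\<close>, subadditivity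
  of \<open>t \<mapsto> t powr (h * \<alpha>)\<close> bounds the deleted mass.
\<close>

section \<open>Inequalities for powers with exponent at most one\<close>

text \<open>For positive \<open>y\<close>, the function \<open>(t + y) powr a - t powr a\<close> of
  \<open>t \<ge> y\<close> is nonincreasing because \<open>a \<le> 1\<close>. Comparing
  \<open>t = x\<close> with \<open>t = y\<close>, where its value is
  \<open>(2 powr a - 1) * y powr a\<close>, gives the gap.\<close>

lemma powr_add_gap:
  fixes x y a :: real
  assumes "0 \<le> y" "y \<le> x" "0 \<le> a" "a \<le> 1"
  shows "(x + y) powr a + (2 - 2 powr a) * y powr a \<le> x powr a + y powr a"
proof (cases "y = 0")
  case True
  then show ?thesis by simp
next
  case False
  with assms have y: "y > 0" by simp
  have "(x + y) powr a - x powr a \<le> (y + y) powr a - y powr a"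
  proof (rule DERIV_nonpos_imp_nonincreasing[OF \<open>y \<le> x\<close>])
    fix t assume t: "y \<le> t" "t \<le> x"
    have "((\<lambda>t. (t + y) powr a - t powr a) has_real_derivative
        a * (t + y) powr (a - 1) - a * t powr (a - 1)) (at t)"
      using t y by (auto intro!: derivative_eq_intros)
    moreover have "a * (t + y) powr (a - 1) \<le> a * t powr (a - 1)"
      using t y assms by (intro mult_left_mono powr_mono2') auto
    ultimately show "\<exists>d. ((\<lambda>t. (t + y) powr a - t powr a) has_real_derivative d) (at t) \<and> d \<le> 0"
      by (intro exI conjI) auto
  qed
  moreover have "(y + y) powr a = 2 powr a * y powr a"
    using y powr_mult[of 2 y a] by (simp flip: mult_2)
  ultimately show ?thesis by (simp add: algebra_simps)
qed

text \<open>Induction merges the elements of \<open>F\<close> one at a time. The accumulated mass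
  \<open>m + sum w F\<close> never falls below \<open>m\<close>, so it dominates each new
  \<open>w u\<close>, as \<open>powr_add_gap\<close> requires.\<close>

lemma powr_sum_gap:
  fixes w :: "'a \<Rightarrow> real" and a :: real
  assumes "finite F" "0 \<le> a" "a \<le> 1" "\<And>u. u \<in> F \<Longrightarrow> 0 \<le> w u \<and> w u \<le> m" "0 \<le> m"
  shows "(m + sum w F) powr a + (2 - 2 powr a) * (\<Sum>u\<in>F. w u powr a) \<le> m powr a + (\<Sum>u\<in>F. w u powr a)"
  using assms(1,4)
proof (induction F)
  case empty
  show ?case by simp
next
  case (insert u F)
  have "w u \<le> m + sum w F" "0 \<le> w u"
    using insert.prems by (auto intro!: add_increasing2 sum_nonneg)
  then have "((m + sum w F) + w u) powr a + (2 - 2 powr a) * w u powr a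
      \<le> (m + sum w F) powr a + w u powr a"
    using assms by (intro powr_add_gap) auto
  moreover have "(m + sum w F) powr a + (2 - 2 powr a) * (\<Sum>u\<in>F. w u powr a)
      \<le> m powr a + (\<Sum>u\<in>F. w u powr a)"
    using insert by auto
  moreover have "m + sum w (insert u F) = (m + sum w F) + w u"
    using insert by simp
  ultimately show ?case
    using insert by (simp add: algebra_simps)
qed

lemma two_powr_le_two: "a \<le> 1 \<Longrightarrow> (2::real) powr a \<le> 2"
  using powr_mono[of a 1 "2::real"] by simp

lemma powr_sum_le:
  fixes p :: "'a \<Rightarrow> real"
  assumes "finite F" "0 \<le> a" "a \<le> 1" "\<And>x. x \<in> F \<Longrightarrow> 0 \<le> p x"
  shows "(sum p F) powr a \<le> (\<Sum>x\<in>F. p x powr a)"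
  using assms(1,4)
proof (induction F)
  case empty
  show ?case by simp
next
  case (insert x F)
  \<comment> \<open>\<open>powr_add_gap\<close> wants the smaller argument second, so this is used
    below in both orders.\<close>
  have sub: "(s + t) powr a \<le> s powr a + t powr a" if "0 \<le> t" "t \<le> s" for s t :: real
  proof -
    have "0 \<le> (2 - 2 powr a) * t powr a"
      using two_powr_le_two[OF assms(3)] by simp
    then show ?thesis using powr_add_gap[OF that assms(2,3)] by linarith
  qed
  have "0 \<le> p x" "0 \<le> sum p F" using insert.prems by (auto intro!: sum_nonneg)
  then have "(p x + sum p F) powr a \<le> p x powr a + (sum p F) powr a"
    using sub[of "p x" "sum p F"] sub[of "sum p F" "p x"] by (cases "p x \<le> sum p F") (auto simp: add.commute)
  then show ?case using insert by fastforce
qed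

section \<open>Merging one class into its heaviest element\<close>

text \<open>Only finitely many elements reach a given positive value \<open>w y\<close>, since
  otherwise \<open>n\<close> of them would sum to more than \<open>infsum w C\<close>. The maximum
  over these is the maximum over \<open>C\<close>.\<close>

lemma summable_on_has_maximum:
  fixes w :: "'a \<Rightarrow> real"
  assumes "w summable_on C" "\<And>u. u \<in> C \<Longrightarrow> 0 \<le> w u" "C \<noteq> {}"
  shows "\<exists>t\<in>C. \<forall>u\<in>C. w u \<le> w t"
proof (cases "\<forall>u\<in>C. w u = 0")
  case True
  then show ?thesis using assms(3) by auto
next
  case False
  then obtain y where y: "y \<in> C" "w y > 0" using assms(2) by force
  define D where "D = {u \<in> C. w y \<le> w u}"
  have "finite D"
  proof (rule ccontr)
    assume "infinite D"
    obtain n :: nat where n: "real n * w y > infsum w C"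
      using reals_Archimedean3 y(2) by blast
    obtain F where F: "F \<subseteq> D" "finite F" "card F = n"
      using infinite_arbitrarily_large[OF \<open>infinite D\<close>] by blast
    have "real n * w y \<le> sum w F"
      using sum_bounded_below[of F "w y" w] F by (auto simp: D_def)
    also have "\<dots> \<le> infsum w C"
      using F assms by (intro finite_sum_le_infsum) (auto simp: D_def)
    finally show False using n by simp
  qed
  moreover have "y \<in> D" using y by (simp add: D_def)
  ultimately have "Max (w ` D) \<in> w ` D" "\<And>u. u \<in> D \<Longrightarrow> w u \<le> Max (w ` D)"
    by (auto intro!: Max_in)
  then obtain t where t: "t \<in> D" "\<And>u. u \<in> D \<Longrightarrow> w u \<le> w t"
    by auto
  show ?thesis
  proof (intro bexI ballI)
    show "t \<in> C" using t by (simp add: D_def)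
    fix u assume "u \<in> C"
    then show "w u \<le> w t"
      using t(2)[of u] t(2)[OF \<open>y \<in> D\<close>] by (cases "u \<in> D") (auto simp: D_def)
  qed
qed

text \<open>The limit of \<open>powr_sum_gap\<close> with \<open>m = w t\<close> along the finite
  subsets of \<open>C - {t}\<close>.\<close>

lemma infsum_powr_gap:
  fixes w :: "'a \<Rightarrow> real" and a :: real
  assumes "0 < a" "a \<le> 1" "t \<in> C"
    and w: "\<And>u. u \<in> C \<Longrightarrow> 0 \<le> w u" "\<And>u. u \<in> C \<Longrightarrow> w u \<le> w t"
    and sw: "w summable_on C" and sa: "(\<lambda>u. w u powr a) summable_on C"
  shows "(infsum w C) powr a + (2 - 2 powr a) * (\<Sum>\<^sub>\<infinity>u\<in>C - {t}. w u powr a)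
    \<le> (\<Sum>\<^sub>\<infinity>u\<in>C. w u powr a)"
proof -
  define D where "D = C - {t}"
  have D: "C = insert t D" "t \<notin> D" using assms(3) by (auto simp: D_def)
  have sw': "w summable_on D" and sa': "(\<lambda>u. w u powr a) summable_on D"
    using sw sa by (auto intro: summable_on_subset simp: D_def)
  let ?F = "finite_subsets_at_top D"
  have "(w t + infsum w D) powr a + (2 - 2 powr a) * (\<Sum>\<^sub>\<infinity>u\<in>D. w u powr a)
      \<le> w t powr a + (\<Sum>\<^sub>\<infinity>u\<in>D. w u powr a)"
  proof (rule tendsto_le)
    show "?F \<noteq> bot" by simp
    show "((\<lambda>F. w t powr a + (\<Sum>u\<in>F. w u powr a)) \<longlongrightarrow>
        w t powr a + (\<Sum>\<^sub>\<infinity>u\<in>D. w u powr a)) ?F"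
      by (intro tendsto_intros infsum_tendsto sa')
    show "((\<lambda>F. (w t + sum w F) powr a + (2 - 2 powr a) * (\<Sum>u\<in>F. w u powr a)) \<longlongrightarrow>
        (w t + infsum w D) powr a + (2 - 2 powr a) * (\<Sum>\<^sub>\<infinity>u\<in>D. w u powr a)) ?F"
      \<comment> \<open>The base tends to 0 if \<open>w\<close> vanishes on \<open>C\<close>;
        continuity of \<open>powr\<close> there rests on \<open>0 < a\<close> and on nonnegative
        bases.\<close>
      using assms(1)
      by (intro tendsto_intros tendsto_powr' infsum_tendsto sa' sw') 
         (auto intro!: eventually_finite_subsets_at_top_weakI add_nonneg_nonneg sum_nonneg w assms(3)
            simp: D_def)
    show "\<forall>\<^sub>F F in ?F. (w t + sum w F) powr a + (2 - 2 powr a) * (\<Sum>u\<in>F. w u powr a)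
        \<le> w t powr a + (\<Sum>u\<in>F. w u powr a)"
      using assms(1-3) w
      by (intro eventually_finite_subsets_at_top_weakI powr_sum_gap) (auto simp: D_def)
  qed
  moreover have "infsum w C = w t + infsum w D"
    unfolding D(1) using sw' D(2) by (rule infsum_insert)
  moreover have "(\<Sum>\<^sub>\<infinity>u\<in>C. w u powr a) = w t powr a + (\<Sum>\<^sub>\<infinity>u\<in>D. w u powr a)"
    unfolding D(1) using sa' D(2) by (rule infsum_insert)
  ultimately show ?thesis by (simp add: D_def)
qed

section \<open>Summing the gap over all classes\<close>

text \<open>\<open>U\<close> is reindexed as the disjoint union of the fibres of \<open>q\<close>.
  Points of \<open>K\<close> outside the image have empty fibres and contribute 0.\<close>

lemma has_sum_fibrewise:
  fixes v :: "'a \<Rightarrow> real"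
  assumes "v summable_on U" "q ` U \<subseteq> K"
  shows "((\<lambda>k. infsum v {u \<in> U. q u = k}) has_sum infsum v U) K"
proof (rule has_sum_SigmaD)
  have bij: "bij_betw snd (Sigma K (\<lambda>k. {u \<in> U. q u = k})) U"
    using assms(2) by (auto simp: bij_betw_def inj_on_def image_iff)
  show "((\<lambda>x. v (snd x)) has_sum infsum v U) (Sigma K (\<lambda>k. {u \<in> U. q u = k}))"
    using has_sum_infsum[OF assms(1)] has_sum_reindex_bij_betw[OF bij, of v] by simp
  fix k
  show "((\<lambda>u. v (snd (k, u))) has_sum infsum v {u \<in> U. q u = k}) {u \<in> U. q u = k}"
    using assms(1) by (auto intro!: has_sum_infsum summable_on_subset[OF assms(1)])
qed

text \<open>\<open>T\<close> takes one heaviest element from each nonempty class;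
  \<open>infsum_powr_gap\<close> holds in each class and is summed over \<open>K\<close>.\<close>

lemma partition_powr_gap:
  fixes w :: "'a \<Rightarrow> real" and a :: real and q :: "'a \<Rightarrow> 'k"
  assumes a: "0 < a" "a \<le> 1"
    and w: "\<And>u. u \<in> U \<Longrightarrow> 0 \<le> w u"
    and sw: "w summable_on U" and sa: "(\<lambda>u. w u powr a) summable_on U"
    and q: "q ` U \<subseteq> K"
  obtains T where "T \<subseteq> U" "inj_on q T"
    "(2 - 2 powr a) * (\<Sum>\<^sub>\<infinity>u\<in>U - T. w u powr a)
       \<le> (\<Sum>\<^sub>\<infinity>u\<in>U. w u powr a) - (\<Sum>\<^sub>\<infinity>k\<in>K. (\<Sum>\<^sub>\<infinity>u\<in>{u \<in> U. q u = k}. w u) powr a)"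
proof -
  define C where "C = (\<lambda>k. {u \<in> U. q u = k})"
  have sub: "w summable_on C k" "(\<lambda>u. w u powr a) summable_on C k" for k
    using sw sa by (auto intro: summable_on_subset simp: C_def)
  have "\<exists>t. t \<in> C k \<and> (\<forall>u\<in>C k. w u \<le> w t)" if "C k \<noteq> {}" for k
    using summable_on_has_maximum[OF sub(1) _ that] w by (auto simp: C_def)
  then obtain t where t: "\<And>k. C k \<noteq> {} \<Longrightarrow> t k \<in> C k"
      "\<And>k u. u \<in> C k \<Longrightarrow> w u \<le> w (t k)"
    by (metis empty_iff)
  define T where "T = t ` {k \<in> K. C k \<noteq> {}}"
  have TU: "T \<subseteq> U" using t(1) by (auto simp: T_def C_def)
  have qt: "q (t k) = k" if "C k \<noteq> {}" for k using t(1)[OF that] by (simp add: C_def)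
  have inj: "inj_on q T"
    unfolding T_def by (auto simp: inj_on_def qt)
  \<comment> \<open>\<open>T\<close> meets class \<open>k\<close> at most in \<open>t k\<close>,
    because \<open>q\<close> recovers \<open>k'\<close> from \<open>t k'\<close>. Hence the sum over
    \<open>U - T\<close> splits into the terms \<open>N k\<close>.\<close>
  have rest: "{u \<in> U - T. q u = k} = C k - {t k}" if "k \<in> K" for k
  proof -
    have "u \<in> T \<longleftrightarrow> u = t k" if "u \<in> C k" for u
    proof
      assume "u \<in> T"
      then obtain k' where "u = t k'" "C k' \<noteq> {}" by (auto simp: T_def)
      then show "u = t k" using qt[of k'] \<open>u \<in> C k\<close> by (simp add: C_def)
    next
      assume "u = t k"
      then show "u \<in> T" using \<open>u \<in> C k\<close> \<open>k \<in> K\<close> by (auto simp: T_def)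
    qed
    then show ?thesis by (auto simp: C_def)
  qed
  define G where "G k = (infsum w (C k)) powr a" for k
  define H where "H k = (\<Sum>\<^sub>\<infinity>u\<in>C k. w u powr a)" for k
  define N where "N k = (\<Sum>\<^sub>\<infinity>u\<in>C k - {t k}. w u powr a)" for k
  have gap: "G k + (2 - 2 powr a) * N k \<le> H k" if "k \<in> K" for k
  proof (cases "C k = {}")
    case True
    then show ?thesis by (simp add: G_def H_def N_def)
  next
    case False
    then show ?thesis
      unfolding G_def H_def N_def using t a w sub
      by (intro infsum_powr_gap) (auto simp: C_def)
  qed
  have d: "0 \<le> 2 - 2 powr a" using two_powr_le_two[OF a(2)] by simp
  have N0: "0 \<le> N k" for k unfolding N_def by (intro infsum_nonneg) simp
  have hs: "(H has_sum (\<Sum>\<^sub>\<infinity>u\<in>U. w u powr a)) K"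
    unfolding H_def C_def by (rule has_sum_fibrewise[OF sa q])
  have "((\<lambda>k. \<Sum>\<^sub>\<infinity>u\<in>{u \<in> U - T. q u = k}. w u powr a) has_sum (\<Sum>\<^sub>\<infinity>u\<in>U - T. w u powr a)) K"
    using q by (intro has_sum_fibrewise summable_on_subset[OF sa]) auto
  then have ns: "(N has_sum (\<Sum>\<^sub>\<infinity>u\<in>U - T. w u powr a)) K"
    by (rule has_sum_cong[THEN iffD1, rotated]) (simp only: N_def rest)
  \<comment> \<open>A non-summable family has \<open>infsum\<close> 0 by default; domination by
    \<open>H\<close> makes \<open>infsum G K\<close> a genuine sum.\<close>
  have "G k \<le> H k" if "k \<in> K" for k
    using gap[OF that] mult_nonneg_nonneg[OF d N0[of k]] by linarith
  then have "G summable_on K"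
    by (intro summable_on_comparison_test[OF has_sum_imp_summable[OF hs]]) (auto simp: G_def)
  then have "((\<lambda>k. G k + (2 - 2 powr a) * N k) has_sum
      infsum G K + (2 - 2 powr a) * (\<Sum>\<^sub>\<infinity>u\<in>U - T. w u powr a)) K"
    by (intro has_sum_add has_sum_infsum has_sum_cmult_right ns)
  from has_sum_mono[OF this hs gap] show thesis
    using that[OF TU inj] by (simp add: G_def[abs_def] C_def algebra_simps)
qed

section \<open>Weights of multisets and the mass of the deleted points\<close>

lemma pmf_replicate_pmf:
  "length xs = n \<Longrightarrow> pmf (replicate_pmf n X) xs = prod_list (map (pmf X) xs)"
proof (induction n arbitrary: xs)
  case 0
  then show ?case by simp
next
  case (Suc n)
  then obtain x ys where xs: "xs = x # ys" "length ys = n" by (cases xs) auto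
  \<comment> \<open>As the image of an independent pair under an injective map, the law has a mass
    function that factors.\<close>
  have "replicate_pmf (Suc n) X = map_pmf (\<lambda>(x, ys). x # ys) (pair_pmf X (replicate_pmf n X))"
    by (simp add: pair_pmf_def map_bind_pmf)
  also have "pmf \<dots> xs = pmf (pair_pmf X (replicate_pmf n X)) (x, ys)"
    using pmf_map_inj'[of "\<lambda>(x, ys). x # ys" _ "(x, ys)"] by (auto simp: xs inj_def)
  finally show ?case using Suc.IH xs by (simp add: pmf_pair)
qed

text \<open>The weight adds up the probabilities of all orderings of \<open>u\<close>; a single
  ordering \<open>xs\<close> already contributes a product of \<open>h\<close> factors, each at
  least \<open>p\<close>.\<close>

lemma weight_ge_power:
  assumes "size u = h" "0 \<le> p" "\<And>x. x \<in># u \<Longrightarrow> p \<le> pmf X x"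
  shows "p ^ h \<le> weight h X u"
proof -
  obtain xs where u: "u = mset xs" using ex_mset by metis
  have "p ^ length ys \<le> prod_list (map (pmf X) ys)" if "\<And>x. x \<in> set ys \<Longrightarrow> p \<le> pmf X x" for ys
    using that
  proof (induction ys)
    case (Cons y ys)
    then show ?case using assms(2) by (auto intro!: mult_mono)
  qed simp
  then have "p ^ h \<le> prod_list (map (pmf X) xs)"
    using assms by (auto simp: u)
  also have "\<dots> = pmf (replicate_pmf h X) xs"
    using assms(1) by (simp add: u pmf_replicate_pmf)
  also have "\<dots> = measure_pmf.prob (replicate_pmf h X) {xs}"
    by (simp add: measure_pmf_single)
  also have "\<dots> \<le> weight h X u"
    unfolding weight_def random_multiset_def pmf_map
    by (intro measure_pmf.finite_measure_mono) (auto simp: u)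
  finally show ?thesis .
qed

lemma summable_on_pmf: "pmf p summable_on A"
  by (rule abs_summable_summable) (use pmf_abs_summable[of p A] in \<open>simp only: abs_summable_equivalent\<close>)

lemma summable_on_weight: "weight h X summable_on U"
  unfolding weight_def[abs_def] by (rule summable_on_pmf)

text \<open>Reduces a possibly infinite deleted set to finite ones, to which
  \<open>powr_sum_le\<close> applies.\<close>

lemma prob_le_of_finite_sums:
  assumes "\<And>F. finite F \<Longrightarrow> F \<subseteq> R \<Longrightarrow> sum (pmf X) F \<le> b"
  shows "measure_pmf.prob X R \<le> b"
proof -
  have "measure_pmf.prob X R = infsum (pmf X) R"
    by (simp add: measure_pmf_conv_infsetsum infsetsum_infsum pmf_abs_summable)
  also have "\<dots> \<le> b"
    using assms by (intro infsum_le_finite_sums summable_on_pmf)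
  finally show ?thesis .
qed

text \<open>\<open>R\<close> collects a least likely element \<open>x u\<close> of each
  \<open>u\<close>. Then \<open>pmf X (x u) ^ h\<close> is at most the weight of \<open>u\<close>;
  raising to the power \<alpha> gives the exponent \<open>h * \<alpha>\<close>, at most 1, as
  subadditivity needs.\<close>

lemma exists_small_transversal:
  fixes X :: "'a pmf" and \<alpha> :: real
  assumes h: "1 \<le> h" and \<alpha>: "0 < \<alpha>" "real h * \<alpha> \<le> 1"
    and N: "\<And>u. u \<in> N \<Longrightarrow> size u = h"
    and sa: "(\<lambda>u. weight h X u powr \<alpha>) summable_on N"
  obtains R where "\<And>u. u \<in> N \<Longrightarrow> \<exists>x\<in>#u. x \<in> R"
    "measure_pmf.prob X R \<le> (\<Sum>\<^sub>\<infinity>u\<in>N. weight h X u powr \<alpha>) powr (1 / (real h * \<alpha>))"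
proof -
  define M where "M = (\<Sum>\<^sub>\<infinity>u\<in>N. weight h X u powr \<alpha>)"
  have "\<exists>x. x \<in># u \<and> (\<forall>y\<in>#u. pmf X x \<le> pmf X y)" if "u \<in> N" for u
  proof -
    have "set_mset u \<noteq> {}" using N[OF that] h by auto
    then show ?thesis
      using arg_min_if_finite[of "set_mset u" "pmf X"]
      by (intro exI[of _ "arg_min_on (pmf X) (set_mset u)"]) force
  qed
  then obtain x where x: "\<And>u. u \<in> N \<Longrightarrow> x u \<in># u"
      "\<And>u y. u \<in> N \<Longrightarrow> y \<in># u \<Longrightarrow> pmf X (x u) \<le> pmf X y"
    by metis
  have pow: "pmf X (x u) powr (real h * \<alpha>) \<le> weight h X u powr \<alpha>" if "u \<in> N" for u
  proof -
    have "pmf X (x u) ^ h \<le> weight h X u"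
      using x(2)[OF that] N[OF that] by (intro weight_ge_power) auto
    then have "(pmf X (x u) ^ h) powr \<alpha> \<le> weight h X u powr \<alpha>"
      using \<alpha> by (intro powr_mono2) auto
    \<comment> \<open>Positivity of \<open>h\<close> matters: \<open>0 ^ 0\<close> is 1 but
      \<open>0 powr 0\<close> is 0.\<close>
    also have "pmf X (x u) ^ h = pmf X (x u) powr real h"
      using h by (simp add: powr_realpow')
    finally show ?thesis by (simp add: powr_powr)
  qed
  have fin: "sum (pmf X) F \<le> M powr (1 / (real h * \<alpha>))" if F: "finite F" "F \<subseteq> x ` N" for F
  proof -
    \<comment> \<open>\<open>v\<close> picks one multiset for each deleted point, so a point that
      serves several multisets is counted once. Its injectivity embeds the sum over \<open>F\<close>
      into the sum over \<open>N\<close>.\<close>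
    obtain v where v: "\<And>r. r \<in> F \<Longrightarrow> v r \<in> N" "\<And>r. r \<in> F \<Longrightarrow> x (v r) = r"
      using F(2) by (metis image_iff subsetD)
    then have inj: "inj_on v F" by (metis inj_onI)
    have "(sum (pmf X) F) powr (real h * \<alpha>) \<le> (\<Sum>r\<in>F. pmf X r powr (real h * \<alpha>))"
      using F \<alpha> by (intro powr_sum_le) auto
    also have "\<dots> \<le> (\<Sum>r\<in>F. weight h X (v r) powr \<alpha>)"
      using pow v by (intro sum_mono) metis
    also have "\<dots> = (\<Sum>u\<in>v ` F. weight h X u powr \<alpha>)"
      using inj by (simp add: sum.reindex)
    also have "\<dots> \<le> M"
      unfolding M_def using F v by (intro finite_sum_le_infsum sa) auto
    finally have "((sum (pmf X) F) powr (real h * \<alpha>)) powr (1 / (real h * \<alpha>))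
        \<le> M powr (1 / (real h * \<alpha>))"
      using \<alpha> by (intro powr_mono2) auto
    then show ?thesis using h \<alpha> by (simp add: powr_powr sum_nonneg)
  qed
  show thesis
  proof
    show "\<exists>y\<in>#u. y \<in> x ` N" if "u \<in> N" for u using x(1)[OF that] that by blast
    show "measure_pmf.prob X (x ` N) \<le> (\<Sum>\<^sub>\<infinity>u\<in>N. weight h X u powr \<alpha>) powr (1 / (real h * \<alpha>))"
      using prob_le_of_finite_sums[OF fin] by (simp add: M_def)
  qed
qed

section \<open>From one colouring to the infimum\<close>

text \<open>The support without \<open>R\<close> competes in the supremum and has probability
  \<open>1 - P(R)\<close>, even if \<open>R\<close> is not inside the support.\<close>

lemma deficiency_le_prob:
  assumes "admissible h (set_pmf X) f g (set_pmf X - R)"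
  shows "deficiency h X f g \<le> measure_pmf.prob X R"
proof -
  have "measure_pmf.prob X (set_pmf X - R)
      \<le> (SUP B \<in> {B. admissible h (set_pmf X) f g B}. measure_pmf.prob X B)"
    using assms by (intro cSUP_upper bdd_aboveI[of _ 1]) auto
  moreover have "measure_pmf.prob X (set_pmf X - R) = 1 - measure_pmf.prob X R"
  proof -
    have "measure_pmf.prob X (set_pmf X - R) = measure_pmf.prob X (UNIV - R)"
      by (intro measure_pmf.finite_measure_eq_AE) (auto simp: AE_measure_pmf_iff)
    then show ?thesis using measure_pmf.prob_compl[of R X] by simp
  qed
  ultimately show ?thesis by (simp add: deficiency_def)
qed

text \<open>The bound for a single colouring: the classes are the fibres of \<open>q\<close>, which
  pairs \<open>f\<close> with \<open>chi\<close>, and \<open>R\<close> hits every multiset outside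
  the transversal \<open>T\<close>.\<close>

lemma deficiency_le_colouring:
  fixes h g :: nat and X :: "'a pmf" and f :: "'a multiset \<Rightarrow> 'b" and \<alpha> :: real
  defines "U \<equiv> multisets_of_size (set_pmf X) h"
  assumes h: "h \<ge> 1" and \<alpha>: "0 < \<alpha>" "\<alpha> < 1" "real h * \<alpha> \<le> 1"
    and sa: "(\<lambda>u. weight h X u powr \<alpha>) summable_on U"
    and chi: "chi \<in> U \<rightarrow> {1..g}"
  shows "deficiency h X f g \<le>
    (\<bar>(\<Sum>\<^sub>\<infinity>u\<in>U. weight h X u powr \<alpha>)
         - (\<Sum>\<^sub>\<infinity>(z, c)\<in>(f ` U) \<times> {1..g}.
              (\<Sum>\<^sub>\<infinity>u\<in>{u \<in> U. f u = z \<and> chi u = c}. weight h X u) powr \<alpha>)\<bar>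
      / \<bar>2 - 2 powr \<alpha>\<bar>) powr (1 / (real h * \<alpha>))"
    (is "_ \<le> (\<bar>?L\<bar> / _) powr _")
proof -
  define q where "q u = (f u, chi u)" for u
  have q: "q ` U \<subseteq> f ` U \<times> {1..g}" using chi by (auto simp: q_def)
  have conv: "(\<lambda>(z, c). (\<Sum>\<^sub>\<infinity>u\<in>{u \<in> U. f u = z \<and> chi u = c}. weight h X u) powr \<alpha>)
      = (\<lambda>k. (\<Sum>\<^sub>\<infinity>u\<in>{u \<in> U. q u = k}. weight h X u) powr \<alpha>)"
    by (simp add: fun_eq_iff q_def)
  have w0: "0 \<le> weight h X u" for u by (simp add: weight_def)
  have "\<alpha> \<le> 1" using \<alpha> by simp
  obtain T where T: "T \<subseteq> U" "inj_on q T"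
    and gap: "(2 - 2 powr \<alpha>) * (\<Sum>\<^sub>\<infinity>u\<in>U - T. weight h X u powr \<alpha>) \<le> ?L"
    unfolding conv by (rule partition_powr_gap[OF \<alpha>(1) \<open>\<alpha> \<le> 1\<close> w0 summable_on_weight sa q])
  \<comment> \<open>Strict because \<open>\<alpha> < 1\<close>, so \<open>gap\<close> can be divided
    by this constant.\<close>
  have d: "2 - 2 powr \<alpha> > 0" using powr_less_mono[of \<alpha> 1 2] \<alpha> by simp
  have size: "size u = h" if "u \<in> U - T" for u
    using that by (simp add: U_def multisets_of_size_def)
  have "(\<lambda>u. weight h X u powr \<alpha>) summable_on U - T"
    by (rule summable_on_subset[OF sa]) auto
  from exists_small_transversal[OF h \<alpha>(1,3) size this]
  obtain R where R: "\<And>u. u \<in> U - T \<Longrightarrow> \<exists>x\<in>#u. x \<in> R"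
    and PR: "measure_pmf.prob X R \<le> (\<Sum>\<^sub>\<infinity>u\<in>U - T. weight h X u powr \<alpha>) powr (1 / (real h * \<alpha>))" by blast
  have "admissible h (set_pmf X) f g (set_pmf X - R)"
    unfolding admissible_def
  proof (intro conjI allI)
    show "set_pmf X - R \<subseteq> set_pmf X" by blast
    fix z
    define S where "S = {u \<in> multisets_of_size (set_pmf X - R) h. f u = z}"
    \<comment> \<open>Multisets avoiding \<open>R\<close> lie in \<open>T\<close>. Since
      \<open>f\<close> is constant on \<open>S\<close>, injectivity of \<open>q\<close> on
      \<open>T\<close> becomes injectivity of \<open>chi\<close> on \<open>S\<close>, and only
      \<open>g\<close> colours exist.\<close>
    have "S \<subseteq> T"
    proof
      fix u assume "u \<in> S"
      then have "u \<in> U" "\<forall>x\<in>#u. x \<notin> R"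
        by (auto simp: S_def U_def multisets_of_size_def)
      then show "u \<in> T" using R by blast
    qed
    moreover have "chi ` S \<subseteq> {1..g}" using chi \<open>S \<subseteq> T\<close> T(1) by blast
    moreover have "inj_on chi S"
      using inj_on_subset[OF T(2) \<open>S \<subseteq> T\<close>] by (auto simp: inj_on_def q_def S_def)
    ultimately show "finite S" "card S \<le> g"
      using inj_on_finite[of chi S "{1..g}"] card_inj_on_le[of chi S "{1..g}"] by auto
  qed
  from deficiency_le_prob[OF this] PR have "deficiency h X f g
      \<le> (\<Sum>\<^sub>\<infinity>u\<in>U - T. weight h X u powr \<alpha>) powr (1 / (real h * \<alpha>))" by simp
  also have "\<dots> \<le> (\<bar>?L\<bar> / \<bar>2 - 2 powr \<alpha>\<bar>) powr (1 / (real h * \<alpha>))"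
    using gap d \<alpha> by (intro powr_mono2 infsum_nonneg) (auto simp: field_simps)
  finally show ?thesis .
qed

theorem theorem1p5:
  fixes h g :: nat and X :: "'a pmf" and f :: "'a multiset \<Rightarrow> 'b" and \<alpha> :: real
  assumes "h \<ge> 2" and "g \<ge> 1"
    and "0 < \<alpha>" and "\<alpha> \<le> 1 / real h"
    and "(\<lambda>u. weight h X u powr \<alpha>) summable_on multisets_of_size (set_pmf X) h"
  shows "deficiency h X f g
           \<le> (colouring_loss h X \<alpha> g f / \<bar>2 - 2 powr \<alpha>\<bar>) powr (1 / (real h * \<alpha>))"
proof (cases "deficiency h X f g \<le> 0")
  case True
  then show ?thesis by (meson order_trans powr_ge_zero)
next
  case False
  define \<delta> where "\<delta> = deficiency h X f g"
  have \<delta>: "0 < \<delta>" using False by (simp add: \<delta>_def)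
  define b where "b = real h * \<alpha>"
  have b: "0 < b" "b \<le> 1" using assms by (auto simp: b_def field_simps)
  have "1 / real h < 1" using assms(1) by simp
  then have \<alpha>: "\<alpha> < 1" using assms(4) by linarith
  have d: "\<bar>2 - 2 powr \<alpha>\<bar> > 0" using powr_less_mono[of \<alpha> 1 2] \<alpha> by simp
  \<comment> \<open>Solved for the loss \<open>l\<close>, the estimate is a lower bound independent
    of the colouring, so it passes to the infimum without any continuity argument.\<close>
  have bound: "\<delta> powr b * \<bar>2 - 2 powr \<alpha>\<bar> \<le> l"
    if "\<delta> \<le> (l / \<bar>2 - 2 powr \<alpha>\<bar>) powr (1 / b)" "0 \<le> l" for l
  proof -
    have "\<delta> powr b \<le> ((l / \<bar>2 - 2 powr \<alpha>\<bar>) powr (1 / b)) powr b"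
      using that \<delta> b by (intro powr_mono2) auto
    also have "\<dots> = l / \<bar>2 - 2 powr \<alpha>\<bar>"
      using b that(2) by (simp add: powr_powr)
    finally show ?thesis using d by (simp add: field_simps)
  qed
  have "\<delta> powr b * \<bar>2 - 2 powr \<alpha>\<bar> \<le> colouring_loss h X \<alpha> g f"
    unfolding colouring_loss_def
  proof (rule cINF_greatest)
    \<comment> \<open>The constant colouring exists since \<open>g \<ge> 1\<close>; an infimum of
      reals needs a nonempty set.\<close>
    have "(\<lambda>_. 1) \<in> multisets_of_size (set_pmf X) h \<rightarrow> {1..g}" using assms(2) by auto
    then show "multisets_of_size (set_pmf X) h \<rightarrow> {1..g} \<noteq> {}" by blast
  next
    fix chi assume "chi \<in> multisets_of_size (set_pmf X) h \<rightarrow> {1..g}"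
    from deficiency_le_colouring[OF _ assms(3) \<alpha> _ assms(5) this, of f]
    show "\<delta> powr b * \<bar>2 - 2 powr \<alpha>\<bar> \<le> \<bar>(\<Sum>\<^sub>\<infinity>u\<in>multisets_of_size (set_pmf X) h. weight h X u powr \<alpha>)
         - (\<Sum>\<^sub>\<infinity>(z, c)\<in>(f ` multisets_of_size (set_pmf X) h) \<times> {1..g}.
              (\<Sum>\<^sub>\<infinity>u\<in>{u \<in> multisets_of_size (set_pmf X) h. f u = z \<and> chi u = c}.
                 weight h X u) powr \<alpha>)\<bar>"
      using assms(1) b by (intro bound) (auto simp: \<delta>_def b_def)
  qed
  then have "\<delta> powr b \<le> colouring_loss h X \<alpha> g f / \<bar>2 - 2 powr \<alpha>\<bar>"
    using d by (simp add: field_simps)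
  then have le: "(\<delta> powr b) powr (1 / b) \<le> (colouring_loss h X \<alpha> g f / \<bar>2 - 2 powr \<alpha>\<bar>) powr (1 / b)"
    using b by (intro powr_mono2) auto
  have "(\<delta> powr b) powr (1 / b) = \<delta>" using b \<delta> by (simp add: powr_powr)
  with le show ?thesis by (simp add: \<delta>_def b_def)
qed

end
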